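(* Let $E$ be a complex Banach lattice and let $T: E \to E$ be a positive linear operator which is weakly almost periodic. Assume that $T$ is irreducible and that there exists a projection band $\{0\} \neq B \subseteq E$ such that $\overline{E_{Tf}} \supseteq \overline{E_f}$ for each $0 \le f \in B$. Then $\sigma_{\mathrm{pnt}}(T) \cap \mathbb{T} \subseteq \{1\}$.
   Context: $E_+$ denotes the positive cone of $E$. For $u \in E_+$, $E_u := \{f \in E : \exists c \ge 0 \text{ with } |f| \le cu\}$ is the principal ideal generated by $u$, and $\overline{E_u}$ is its norm closure. $T$ is positive if $TE_+ \subseteq E_+$. $T$ is weakly almost periodic if for each $f \in E$ the orbit $\{T^n f : n \ge 0\}$ is relatively compact in the weak topology on $E$. A positive operator $T$ is irreducible if for each non-zero $f \in E_+$ and each non-zero functional $\varphi \ge 0$ in the norm dual $E'$ there exists an integer $n \ge 0$ such that $\langle \varphi, T^n f\rangle > 0$ (equivalently, $\{0\}$ and $E$ are the only closed $T$-invariant ideals in $E$). A vector subspace $B \subseteq E$ is a projection band if there exists a bounded linear projection $P$ on $E$ with range $B$ satisfying $0 \le Pf \le f$ for all $f \in E_+$. $\mathbb{T} := \{\lambda \in \mathbb{C} : |\lambda| = 1\}$, and $\sigma_{\mathrm{pnt}}(T)$ denotes the point spectrum (set of eigenvalues) of $T$. *)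

theory Defs
  imports "HOL-Analysis.Analysis" "HOL-Library.Lattice_Algebras" "HOL-Library.Complex_Order"
begin

section \<open>Real Banach lattices\<close>

class real_banach_lattice = banach + ordered_real_vector + lattice_ab_group_add_abs +
  assumes norm_abs_mono: "\<bar>x\<bar> \<le> \<bar>y\<bar> \<Longrightarrow> norm x \<le> norm y"

instance real :: real_banach_lattice
  by standard simp

lemma norm_abs_lattice [simp]: "norm \<bar>x\<bar> = norm x" for x :: "'a::real_banach_lattice"
  by (rule antisym) (auto intro: norm_abs_mono)

lemma norm_mono_nonneg: "0 \<le> x \<Longrightarrow> x \<le> y \<Longrightarrow> norm x \<le> norm y"
  for x y :: "'a::real_banach_lattice"
  by (rule norm_abs_mono) (auto dest: order_trans)

lemma pprt_lipschitz: "\<bar>pprt x - pprt y\<bar> \<le> \<bar>x - y\<bar>" for x y :: "'a::lattice_ab_group_add_abs"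
proof -
  have *: "pprt a \<le> pprt b + \<bar>a - b\<bar>" for a b :: 'a
  proof -
    have "a \<le> b + \<bar>a - b\<bar>"
      using abs_ge_self[of "a - b"] by (simp add: algebra_simps)
    also have "\<dots> \<le> pprt b + \<bar>a - b\<bar>" by (simp add: pprt_def)
    finally have "a \<le> pprt b + \<bar>a - b\<bar>" .
    then show ?thesis
      by (subst pprt_def) simp
  qed
  from *[of x y] *[of y x] show ?thesis
    by (simp add: abs_le_iff algebra_simps abs_minus_commute)
qed

lemma real_banach_lattice_limit_le:
  fixes a :: "'a::real_banach_lattice"
  assumes X: "X \<longlonglongrightarrow> a" and Y: "Y \<longlonglongrightarrow> b" and le: "\<And>n. X n \<le> Y n"
  shows "a \<le> b"
proof -
  have "(\<lambda>n. X n - Y n) \<longlonglongrightarrow> a - b" by (intro tendsto_diff X Y)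
  then have "(\<lambda>n. norm ((X n - Y n) - (a - b))) \<longlonglongrightarrow> 0"
    by (simp add: LIM_zero tendsto_norm_zero)
  moreover have "norm (pprt (a - b)) \<le> norm ((X n - Y n) - (a - b))" for n
  proof -
    have "pprt (X n - Y n) = 0" using le[of n] by simp
    with pprt_lipschitz[of "X n - Y n" "a - b"]
    have "\<bar>- pprt (a - b)\<bar> \<le> \<bar>(X n - Y n) - (a - b)\<bar>" by simp
    from norm_abs_mono[OF this] show ?thesis by simp
  qed
  ultimately have "norm (pprt (a - b)) \<le> 0"
    by (intro LIMSEQ_le_const) auto
  then show ?thesis by (simp flip: le_zero_iff_zero_pprt)
qed

lemma scaleR_le_abs_lattice: "r *\<^sub>R x \<le> \<bar>r\<bar> *\<^sub>R \<bar>x\<bar>" for x :: "'a::real_banach_lattice"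
proof (cases "0 \<le> r")
  case True
  then show ?thesis by (simp add: scaleR_left_mono abs_ge_self)
next
  case False
  then have "(- r) *\<^sub>R (- x) \<le> (- r) *\<^sub>R \<bar>x\<bar>"
    by (intro scaleR_left_mono) (auto simp: abs_ge_minus_self)
  with False show ?thesis by simp
qed


section \<open>The modulus on the complexification\<close>

datatype 'a complexification = Cplx (real_part: 'a) (imag_part: 'a)

text \<open>\<^term>\<open>rot z \<theta>\<close> is the real part of \<open>exp (- \<i> \<theta>) z\<close>.\<close>

definition rot :: "'a::real_vector complexification \<Rightarrow> real \<Rightarrow> 'a"
  where "rot z \<theta> = cos \<theta> *\<^sub>R real_part z + sin \<theta> *\<^sub>R imag_part z"

text \<open>The modulus is the supremum of the real parts of all rotations of \<open>z\<close>; it exists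
  in every Banach lattice (\<open>is_modulus_modulus\<close> below).\<close>

definition is_modulus :: "'a::real_banach_lattice complexification \<Rightarrow> 'a \<Rightarrow> bool"
  where "is_modulus z m \<longleftrightarrow> (\<forall>\<theta>. rot z \<theta> \<le> m) \<and> (\<forall>b. (\<forall>\<theta>. rot z \<theta> \<le> b) \<longrightarrow> m \<le> b)"

definition modulus :: "'a::real_banach_lattice complexification \<Rightarrow> 'a"
  where "modulus z = (THE m. is_modulus z m)"

lemma abs_cos_diff_le: "\<bar>cos a - cos b\<bar> \<le> \<bar>a - b\<bar>" for a b :: real
proof -
  have "\<bar>cos a - cos b\<bar> = 2 * (\<bar>sin ((a + b) / 2)\<bar> * \<bar>sin ((b - a) / 2)\<bar>)"
    by (simp add: cos_diff_cos abs_mult)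
  also have "\<dots> \<le> 2 * (1 * \<bar>(b - a) / 2\<bar>)"
    by (intro mult_left_mono mult_mono abs_sin_x_le_abs_x abs_sin_le_one) auto
  finally show ?thesis by simp
qed

lemma abs_sin_diff_le: "\<bar>sin a - sin b\<bar> \<le> \<bar>a - b\<bar>" for a b :: real
  using abs_cos_diff_le[of "pi / 2 - a" "pi / 2 - b"] by (simp add: cos_diff)

lemma rot_diff_le:
  fixes z :: "'a::real_banach_lattice complexification"
  shows "rot z a \<le> rot z b + \<bar>a - b\<bar> *\<^sub>R (\<bar>real_part z\<bar> + \<bar>imag_part z\<bar>)"
proof -
  let ?x = "real_part z" and ?y = "imag_part z"
  have "rot z a - rot z b = (cos a - cos b) *\<^sub>R ?x + (sin a - sin b) *\<^sub>R ?y"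
    by (simp add: rot_def algebra_simps)
  also have "\<dots> \<le> \<bar>cos a - cos b\<bar> *\<^sub>R \<bar>?x\<bar> + \<bar>sin a - sin b\<bar> *\<^sub>R \<bar>?y\<bar>"
    by (intro add_mono scaleR_le_abs_lattice)
  also have "\<dots> \<le> \<bar>a - b\<bar> *\<^sub>R \<bar>?x\<bar> + \<bar>a - b\<bar> *\<^sub>R \<bar>?y\<bar>"
    by (intro add_mono scaleR_right_mono abs_cos_diff_le abs_sin_diff_le) auto
  finally show ?thesis by (simp add: algebra_simps)
qed

lemma ex_is_modulus: "\<exists>m. is_modulus (z :: 'a::real_banach_lattice complexification) m"
proof -
  define w where "w = \<bar>real_part z\<bar> + \<bar>imag_part z\<bar>"
  have w0: "0 \<le> w" by (simp add: w_def)
  define G :: "nat \<Rightarrow> 'a set" where "G n = (\<lambda>i. rot z (real i / real (Suc n))) ` {..7 * Suc n}" for n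
  define s where "s n = Sup_fin (G n)" for n
  have G: "finite (G n)" "G n \<noteq> {}" for n by (auto simp: G_def)
  have up: "rot z t \<le> s n + (1 / real (Suc n)) *\<^sub>R w" for t n
  proof -
    obtain t' where t': "0 \<le> t'" "t' < 2 * pi" "sin t = sin t'" "cos t = cos t'"
      by (rule sincos_total_2pi[of "cos t" "sin t"]) auto
    define i where "i = nat \<lfloor>t' * real (Suc n)\<rfloor>"
    have i1: "real i \<le> t' * real (Suc n)" and i2: "t' * real (Suc n) \<le> real i + 1"
      using of_nat_floor[of "t' * real (Suc n)"] real_nat_ceiling_ge t'(1) floor_correct[of "t' * real (Suc n)"]
      by (simp_all add: i_def del: of_nat_Suc)
    have "real i \<le> real (7 * Suc n)"
    proof -
      have "t' \<le> 7" using t'(2) pi_less_4 pi_approx(2) by simp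
      then have "t' * real (Suc n) \<le> 7 * real (Suc n)" by (intro mult_right_mono) auto
      with i1 show ?thesis by simp
    qed
    then have iG: "rot z (real i / real (Suc n)) \<in> G n" by (auto simp: G_def simp del: of_nat_Suc of_nat_mult)
    have "\<bar>t' - real i / real (Suc n)\<bar> \<le> 1 / real (Suc n)"
    proof -
      have "t' - real i / real (Suc n) = (t' * real (Suc n) - real i) / real (Suc n)"
        by (simp add: diff_divide_distrib del: of_nat_Suc)
      also have "\<bar>\<dots>\<bar> \<le> 1 / real (Suc n)"
        using i1 i2 by (simp add: abs_divide divide_right_mono abs_le_iff del: of_nat_Suc)
      finally show ?thesis .
    qed
    then have d: "\<bar>t' - real i / real (Suc n)\<bar> *\<^sub>R w \<le> (1 / real (Suc n)) *\<^sub>R w"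
      by (intro scaleR_right_mono w0)
    have "rot z t = rot z t'" by (simp add: rot_def t')
    also have "\<dots> \<le> rot z (real i / real (Suc n)) + \<bar>t' - real i / real (Suc n)\<bar> *\<^sub>R w"
      unfolding w_def by (rule rot_diff_le)
    also have "\<dots> \<le> s n + (1 / real (Suc n)) *\<^sub>R w"
      unfolding s_def by (intro add_mono d Sup_fin.coboundedI G iG)
    finally show ?thesis .
  qed
  have le: "s n \<le> b" if "\<And>t. rot z t \<le> b" for n b
    unfolding s_def using that by (intro Sup_fin.boundedI G) (auto simp: G_def)
  have diff: "norm (s m - s n) \<le> (1 / real (Suc N)) * norm w" if "N \<le> m" "N \<le> n" for m n N
  proof -
    have *: "s m - s n \<le> (1 / real (Suc N)) *\<^sub>R w" if "N \<le> m" "N \<le> n" for m n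
    proof -
      have "s m \<le> s n + (1 / real (Suc n)) *\<^sub>R w" by (intro le up)
      also have "\<dots> \<le> s n + (1 / real (Suc N)) *\<^sub>R w"
        using that by (intro add_mono scaleR_right_mono w0) (auto simp: field_simps)
      finally show ?thesis by (simp add: algebra_simps)
    qed
    have "\<bar>s m - s n\<bar> \<le> (1 / real (Suc N)) *\<^sub>R w"
      using *[OF that] *[OF that(2) that(1)] by (simp add: abs_le_iff)
    then have "norm (s m - s n) \<le> norm ((1 / real (Suc N)) *\<^sub>R w)"
      using norm_mono_nonneg[of "\<bar>s m - s n\<bar>" "(1 / real (Suc N)) *\<^sub>R w"] by simp
    then show ?thesis by simp
  qed
  have "Cauchy s"
  proof (rule metric_CauchyI)
    fix e :: real assume "0 < e"
    then obtain N where "norm w / e < real N" using reals_Archimedean2 by blast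
    with \<open>0 < e\<close> have N: "(1 / real (Suc N)) * norm w < e"
      by (simp add: field_simps)
    show "\<exists>M. \<forall>m\<ge>M. \<forall>n\<ge>M. dist (s m) (s n) < e"
      by (intro exI[of _ N] allI impI) (simp only: dist_norm, rule le_less_trans[OF diff N])
  qed
  then obtain m where m: "s \<longlonglongrightarrow> m" using Cauchy_convergent convergent_def by blast
  have "(\<lambda>n. s n + (1 / real (Suc n)) *\<^sub>R w) \<longlonglongrightarrow> m + 0 *\<^sub>R w"
    using LIMSEQ_inverse_real_of_nat by (intro tendsto_intros m) (simp add: inverse_eq_divide)
  then have "rot z t \<le> m" for t
    using real_banach_lattice_limit_le[OF tendsto_const _ up] by simp
  moreover have "m \<le> b" if "\<And>t. rot z t \<le> b" for b
    using real_banach_lattice_limit_le[OF m tendsto_const] le that by blast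
  ultimately show ?thesis unfolding is_modulus_def by blast
qed

lemma is_modulus_modulus: "is_modulus z (modulus z)"
proof -
  have "\<exists>!m. is_modulus z m"
    using ex_is_modulus[of z] by (auto simp: is_modulus_def intro: antisym)
  then show ?thesis unfolding modulus_def by (rule theI')
qed

lemma rot_le_modulus: "rot z \<theta> \<le> modulus z"
  and modulus_least: "(\<And>\<theta>. rot z \<theta> \<le> b) \<Longrightarrow> modulus z \<le> b"
  using is_modulus_modulus[of z] by (auto simp: is_modulus_def)

lemma abs_real_part_le_modulus: "\<bar>real_part z\<bar> \<le> modulus z"
  using rot_le_modulus[of z 0] rot_le_modulus[of z pi] by (simp add: rot_def abs_le_iff)

lemma abs_imag_part_le_modulus: "\<bar>imag_part z\<bar> \<le> modulus z"
  using rot_le_modulus[of z "pi / 2"] rot_le_modulus[of z "- (pi / 2)"]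
  by (simp add: rot_def abs_le_iff)

lemma modulus_nonneg [simp]: "0 \<le> modulus z"
  using abs_real_part_le_modulus[of z] abs_ge_zero[of "real_part z"] by (rule order_trans[rotated])

lemma modulus_le_sum: "modulus z \<le> \<bar>real_part z\<bar> + \<bar>imag_part z\<bar>"
proof (rule modulus_least)
  fix t
  have "rot z t \<le> \<bar>cos t\<bar> *\<^sub>R \<bar>real_part z\<bar> + \<bar>sin t\<bar> *\<^sub>R \<bar>imag_part z\<bar>"
    unfolding rot_def by (intro add_mono scaleR_le_abs_lattice)
  also have "\<dots> \<le> 1 *\<^sub>R \<bar>real_part z\<bar> + 1 *\<^sub>R \<bar>imag_part z\<bar>"
    by (intro add_mono scaleR_right_mono) auto
  finally show "rot z t \<le> \<bar>real_part z\<bar> + \<bar>imag_part z\<bar>" by simp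
qed


section \<open>Complex Banach lattices\<close>

text \<open>A complex Banach lattice is the complexification of a real Banach lattice with norm
  \<open>norm z = norm \<bar>z\<bar>\<close>, so it is rendered as the type \<open>'a complexification\<close> for
  \<open>'a :: real_banach_lattice\<close>. The order is the one induced by the cone of the real lattice:
  \<open>z \<le> w\<close> iff \<open>w - z\<close> is real and nonnegative.\<close>

instantiation complexification :: (real_vector) real_vector
begin
definition "0 = Cplx 0 0"
definition "z + w = Cplx (real_part z + real_part w) (imag_part z + imag_part w)"
definition "z - w = Cplx (real_part z - real_part w) (imag_part z - imag_part w)"
definition "- z = Cplx (- real_part z) (- imag_part z)"
definition "r *\<^sub>R z = Cplx (r *\<^sub>R real_part z) (r *\<^sub>R imag_part z)"
instance
  by standard
    (auto simp: zero_complexification_def plus_complexification_def minus_complexification_def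
      uminus_complexification_def scaleR_complexification_def algebra_simps)
end

lemma complexification_part_simps [simp]:
  "real_part 0 = 0" "imag_part 0 = 0"
  "real_part (z + w) = real_part z + real_part w" "imag_part (z + w) = imag_part z + imag_part w"
  "real_part (z - w) = real_part z - real_part w" "imag_part (z - w) = imag_part z - imag_part w"
  "real_part (- z) = - real_part z" "imag_part (- z) = - imag_part z"
  "real_part (r *\<^sub>R z) = r *\<^sub>R real_part z" "imag_part (r *\<^sub>R z) = r *\<^sub>R imag_part z"
  by (auto simp: zero_complexification_def plus_complexification_def minus_complexification_def
      uminus_complexification_def scaleR_complexification_def)

definition scaleC :: "complex \<Rightarrow> 'a::real_vector complexification \<Rightarrow> 'a complexification"
    (infixr \<open>*\<^sub>C\<close> 75)
  where "a *\<^sub>C z = Cplx (Re a *\<^sub>R real_part z - Im a *\<^sub>R imag_part z)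
                     (Re a *\<^sub>R imag_part z + Im a *\<^sub>R real_part z)"

lemma scaleC_part_simps [simp]:
  "real_part (a *\<^sub>C z) = Re a *\<^sub>R real_part z - Im a *\<^sub>R imag_part z"
  "imag_part (a *\<^sub>C z) = Re a *\<^sub>R imag_part z + Im a *\<^sub>R real_part z"
  by (simp_all add: scaleC_def)

interpretation complexification: vector_space "scaleC :: complex \<Rightarrow> 'a::real_vector complexification \<Rightarrow> _"
  by standard (auto intro!: complexification.expand simp: algebra_simps)

lemma scaleR_eq_scaleC: "r *\<^sub>R z = complex_of_real r *\<^sub>C z"
  by (rule complexification.expand) simp

instantiation complexification :: (real_banach_lattice) ordered_real_vector
begin
definition less_eq_complexification :: "'a complexification \<Rightarrow> 'a complexification \<Rightarrow> bool"
  where "z \<le> w \<longleftrightarrow> real_part z \<le> real_part w \<and> imag_part z = imag_part w"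
definition less_complexification :: "'a complexification \<Rightarrow> 'a complexification \<Rightarrow> bool"
  where "z < w \<longleftrightarrow> real_part z < real_part w \<and> imag_part z = imag_part w"
instance
  by standard
    (auto simp: less_eq_complexification_def less_complexification_def
      intro: complexification.expand scaleR_left_mono scaleR_right_mono order_trans)
end

instantiation complexification :: (real_banach_lattice) abs
begin
definition "\<bar>z\<bar> = Cplx (modulus z) 0"
instance ..
end

lemma modulus_triangle: "modulus (z + w) \<le> modulus z + modulus w"
proof (rule modulus_least)
  fix t
  have "rot (z + w) t = rot z t + rot w t" by (simp add: rot_def algebra_simps)
  then show "rot (z + w) t \<le> modulus z + modulus w" by (simp add: add_mono rot_le_modulus)
qed

lemma modulus_scaleC: "modulus (a *\<^sub>C z) = cmod a *\<^sub>R modulus z"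
proof -
  have *: "modulus (a *\<^sub>C z) \<le> cmod a *\<^sub>R modulus z" for a z
  proof (rule modulus_least)
    fix t
    obtain u where u: "Re a = cmod a * cos u" "Im a = cmod a * sin u"
      using that[of "Arg a"] Re_rcis[of "cmod a" "Arg a"] Im_rcis[of "cmod a" "Arg a"]
      by (simp add: rcis_cmod_Arg)
    have "rot (a *\<^sub>C z) t = cmod a *\<^sub>R rot z (t - u)"
      by (simp add: rot_def u cos_diff sin_diff algebra_simps)
    then show "rot (a *\<^sub>C z) t \<le> cmod a *\<^sub>R modulus z"
      by (simp add: scaleR_left_mono rot_le_modulus)
  qed
  have "cmod a *\<^sub>R modulus z \<le> modulus (a *\<^sub>C z)"
  proof (cases "a = 0")
    case False
    have "modulus z = modulus (inverse a *\<^sub>C a *\<^sub>C z)" using False by simp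
    also have "\<dots> \<le> cmod (inverse a) *\<^sub>R modulus (a *\<^sub>C z)" by (rule *)
    finally have "cmod a *\<^sub>R modulus z \<le> cmod a *\<^sub>R (cmod (inverse a) *\<^sub>R modulus (a *\<^sub>C z))"
      by (rule scaleR_left_mono) simp
    with False show ?thesis by (simp add: norm_inverse)
  qed simp
  with * show ?thesis by (intro antisym)
qed

instantiation complexification :: (real_banach_lattice) real_normed_vector
begin
definition "norm z = norm (modulus z)"
definition "sgn z = inverse (norm z) *\<^sub>R z" for z :: "'a complexification"
definition "dist z w = norm (z - w)" for z w :: "'a complexification"
definition "uniformity = (INF e\<in>{0<..}. principal {(z, w :: 'a complexification). dist z w < e})"
definition "open U \<longleftrightarrow> (\<forall>z\<in>U. eventually (\<lambda>(z', w). z' = z \<longrightarrow> w \<in> U) uniformity)"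
  for U :: "'a complexification set"
instance
proof
  fix z w :: "'a complexification" and r :: real
  show "norm z = 0 \<longleftrightarrow> z = 0"
  proof
    assume "norm z = 0"
    then have m: "modulus z = 0" by (simp add: norm_complexification_def)
    have "\<bar>real_part z\<bar> \<le> 0" "\<bar>imag_part z\<bar> \<le> 0"
      using abs_real_part_le_modulus[of z] abs_imag_part_le_modulus[of z] by (simp_all add: m)
    then show "z = 0" by (auto intro: complexification.expand)
  next
    assume "z = 0"
    then have "modulus z \<le> 0" using modulus_le_sum[of z] by simp
    then have "modulus z = 0" by (rule antisym) simp
    then show "norm z = 0" by (simp add: norm_complexification_def)
  qed
  show "norm (z + w) \<le> norm z + norm w"
    unfolding norm_complexification_def
    using norm_mono_nonneg[OF modulus_nonneg modulus_triangle[of z w]] norm_triangle_ineq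
    by (rule order_trans)
  show "norm (r *\<^sub>R z) = \<bar>r\<bar> * norm z"
    by (simp add: norm_complexification_def scaleR_eq_scaleC modulus_scaleC)
qed (rule sgn_complexification_def dist_complexification_def
    uniformity_complexification_def open_complexification_def)+
end

lemma norm_scaleC: "norm (a *\<^sub>C z) = cmod a * norm z"
  by (simp add: norm_complexification_def modulus_scaleC)

lemma norm_real_part_le: "norm (real_part z) \<le> norm z"
  and norm_imag_part_le: "norm (imag_part z) \<le> norm z"
  and norm_le_sum_parts: "norm z \<le> norm (real_part z) + norm (imag_part z)"
proof -
  show "norm (real_part z) \<le> norm z" "norm (imag_part z) \<le> norm z"
    unfolding norm_complexification_def
    using norm_mono_nonneg[OF _ abs_real_part_le_modulus[of z]]
      norm_mono_nonneg[OF _ abs_imag_part_le_modulus[of z]] by auto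
  have "norm z \<le> norm (\<bar>real_part z\<bar> + \<bar>imag_part z\<bar>)"
    unfolding norm_complexification_def by (intro norm_mono_nonneg modulus_le_sum) simp
  then show "norm z \<le> norm (real_part z) + norm (imag_part z)"
    using norm_triangle_ineq[of "\<bar>real_part z\<bar>" "\<bar>imag_part z\<bar>"] by simp
qed

instance complexification :: (real_banach_lattice) banach
proof
  fix X :: "nat \<Rightarrow> 'a complexification"
  assume X: "Cauchy X"
  have "Cauchy (\<lambda>n. real_part (X n))" "Cauchy (\<lambda>n. imag_part (X n))"
    using X norm_real_part_le[of "X _ - X _"] norm_imag_part_le[of "X _ - X _"]
    unfolding Cauchy_def dist_norm complexification_part_simps by (meson le_less_trans)+
  then obtain x y where x: "(\<lambda>n. real_part (X n)) \<longlonglongrightarrow> x" and y: "(\<lambda>n. imag_part (X n)) \<longlonglongrightarrow> y"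
    using Cauchy_convergent convergent_def by blast
  have "(\<lambda>n. norm (real_part (X n) - x) + norm (imag_part (X n) - y)) \<longlonglongrightarrow> 0"
    using x y by (intro tendsto_add_zero tendsto_norm_zero) (auto intro: LIM_zero)
  moreover have "norm (norm (X n - Cplx x y)) \<le> norm (real_part (X n) - x) + norm (imag_part (X n) - y)" for n
    using norm_le_sum_parts[of "X n - Cplx x y"] by simp
  ultimately have "(\<lambda>n. norm (X n - Cplx x y)) \<longlonglongrightarrow> 0"
    by (rule Lim_null_comparison[OF always_eventually[OF allI], rotated])
  then have "X \<longlonglongrightarrow> Cplx x y" by (simp add: LIM_zero_iff tendsto_norm_zero_iff)
  then show "convergent X" by (rule convergentI)
qed


section \<open>Operators on complex Banach lattices\<close>

abbreviation clinear_op ::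
    "('a::real_banach_lattice complexification \<Rightarrow> 'a complexification) \<Rightarrow> bool"
  where "clinear_op T \<equiv> Vector_Spaces.linear scaleC scaleC T"

definition positive_op ::
    "('a::real_banach_lattice complexification \<Rightarrow> 'a complexification) \<Rightarrow> bool"
  where "positive_op T \<longleftrightarrow> (\<forall>f\<ge>0. 0 \<le> T f)"

definition norm_dual :: "('a::real_banach_lattice complexification \<Rightarrow> complex) set"
  where "norm_dual = {\<phi>. Vector_Spaces.linear scaleC (*) \<phi> \<and> bounded_linear \<phi>}"

definition weak_topology :: "'a::real_banach_lattice complexification topology"
  where "weak_topology = topology_generated_by {\<phi> -` U | \<phi> U. \<phi> \<in> norm_dual \<and> open U}"

definition weakly_almost_periodic ::
    "('a::real_banach_lattice complexification \<Rightarrow> 'a complexification) \<Rightarrow> bool"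
  where "weakly_almost_periodic T \<longleftrightarrow>
    (\<forall>f. compactin weak_topology (weak_topology closure_of (range (\<lambda>n. (T ^^ n) f))))"

text \<open>Inequalities between complex numbers (here and in HOL-Library.Complex_Order) mean that
  the difference is real, so \<open>0 < \<langle>\<phi>, T\<^sup>n f\<rangle>\<close> says that this number is real and strictly
  positive.\<close>

definition irreducible_op ::
    "('a::real_banach_lattice complexification \<Rightarrow> 'a complexification) \<Rightarrow> bool"
  where "irreducible_op T \<longleftrightarrow>
    (\<forall>f \<phi>. 0 \<le> f \<and> f \<noteq> 0 \<and> \<phi> \<in> norm_dual \<and> (\<forall>g\<ge>0. 0 \<le> \<phi> g) \<and> \<phi> \<noteq> (\<lambda>_. 0) \<longrightarrow>
      (\<exists>n. 0 < \<phi> ((T ^^ n) f)))"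

definition principal_ideal ::
    "'a::real_banach_lattice complexification \<Rightarrow> 'a complexification set"
  where "principal_ideal u = {f. \<exists>c\<ge>0. \<bar>f\<bar> \<le> c *\<^sub>R u}"

definition projection_band :: "'a::real_banach_lattice complexification set \<Rightarrow> bool"
  where "projection_band B \<longleftrightarrow> module.subspace scaleC B \<and>
    (\<exists>P. clinear_op P \<and> bounded_linear P \<and> P \<circ> P = P \<and> range P = B \<and>
      (\<forall>f\<ge>0. 0 \<le> P f \<and> P f \<le> f))"

definition point_spectrum ::
    "('a::real_banach_lattice complexification \<Rightarrow> 'a complexification) \<Rightarrow> complex set"
  where "point_spectrum T = {\<mu>. \<exists>f. f \<noteq> 0 \<and> T f = \<mu> *\<^sub>C f}"

end

theory Submission
  imports Defs
begin

text \<open>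
  Let \<open>T f = \<mu> f\<close> with \<open>f \<noteq> 0\<close>, \<open>\<bar>\<mu>\<bar> = 1\<close> and \<open>\<mu> \<noteq> 1\<close>, and put \<open>u = \<bar>f\<bar>\<close> and \<open>R w = Re (w f)\<close>, so that
  \<open>T (R w) = R (\<mu> w)\<close>. The idea is that \<open>T\<close> rotates: what lives where \<open>f\<close> has argument close to
  \<open>\<theta>\<close> is moved to where \<open>f\<close> has argument close to \<open>\<theta> - arg \<mu>\<close>, hence to something disjoint from it.
  Cutting a positive vector of \<open>B\<close> into pieces with small argument range gives positive vectors
  \<open>h\<close> in \<open>B\<close> that are disjoint from \<open>T h\<close>, and these must vanish by the hypothesis on \<open>B\<close>.

  To make this work, the modulus \<open>u\<close> has to be a fixed vector. Positivity gives only
  \<open>u \<le> T u\<close>. The orbits of \<open>T\<close> are weakly bounded, so a Banach limit along Cesaro means produces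
  a \<open>T\<close>-invariant positive functional \<open>\<phi>\<close> with \<open>\<phi> u > 0\<close> (\<open>ex_invariant_functional\<close>), and
  irreducibility makes every such \<open>\<phi>\<close> strictly positive. Since \<open>\<phi> (T u - u) = 0\<close>, it follows that
  \<open>T u = u\<close>.

  For unimodular \<open>w\<close> and \<open>c < 1\<close> close to \<open>1\<close>, the vector \<open>a w = (R w - c u)\<^sup>+\<close> lives where \<open>f\<close>
  has argument near \<open>- arg w\<close>. Positivity yields \<open>a (\<mu> w) \<le> T (a w)\<close>;
  because some powers of \<open>\<mu>\<close> come back arbitrarily close to \<open>1\<close>, \<open>\<phi>\<close> cannot decrease along the
  orbit of \<open>w\<close>, and strict positivity gives \<open>a (\<mu> w) = T (a w)\<close> (\<open>pprt_rotation\<close>). For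
  \<open>c = \<bar>1 + \<mu>\<bar> / 2\<close> the vectors \<open>a w\<close> and \<open>a (\<mu> w)\<close> are disjoint (\<open>inf_pprt_eq_0\<close>). With \<open>P\<close> the
  band projection onto \<open>B\<close>, the vector \<open>h = P (a w)\<close> lies in \<open>B\<close> below \<open>a w\<close>, so it is disjoint
  from \<open>T h\<close>, and membership of \<open>h\<close> in the closed ideal generated by \<open>T h\<close> forces \<open>h = 0\<close>
  (\<open>norm_le_dist_disjoint\<close>). Therefore \<open>P (R w) \<le> c P u\<close> for all unimodular \<open>w\<close>, and taking the
  supremum over \<open>w\<close> of \<open>R w = P (R w) + (R w - P (R w)) \<le> c P u + (u - P u)\<close> gives
  \<open>P u \<le> c P u\<close>, that is \<open>P u = 0\<close>. As \<open>u\<close> is fixed by \<open>T\<close>, irreducibility applied to \<open>u\<close> and to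
  functionals of the form \<open>\<psi> \<circ> P\<close> shows \<open>P = 0\<close>, which contradicts \<open>B \<noteq> {0}\<close>.

  All positive functionals come from the sublinear form of the Hahn--Banach theorem, which is
  proved first; on a Banach lattice they are automatically norm bounded, so that they belong to
  the dual space.
\<close>

section \<open>The Hahn--Banach theorem\<close>

definition sublinear :: "('a::real_vector \<Rightarrow> real) \<Rightarrow> bool"
  where "sublinear p \<longleftrightarrow> (\<forall>x y. p (x + y) \<le> p x + p y) \<and> (\<forall>t x. 0 < t \<longrightarrow> p (t *\<^sub>R x) \<le> t * p x)"

lemma sublinear_add: "sublinear p \<Longrightarrow> p (x + y) \<le> p x + p y"
  by (simp add: sublinear_def)

lemma sublinear_zero: "sublinear p \<Longrightarrow> p 0 = 0"
proof -
  assume p: "sublinear p"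
  have "p 0 \<le> (1/2) * p 0"
    using p unfolding sublinear_def by (metis half_gt_zero_iff scale_zero_right zero_less_one)
  moreover have "p 0 \<le> p 0 + p 0" using sublinear_add[OF p, of 0 0] by simp
  ultimately show ?thesis by simp
qed

lemma sublinear_scale:
  assumes p: "sublinear p" and t: "0 \<le> t"
  shows "p (t *\<^sub>R x) = t * p x"
proof (cases "t = 0")
  case True
  then show ?thesis by (simp add: sublinear_zero[OF p])
next
  case False
  with t have t: "0 < t" by simp
  have le: "p (t *\<^sub>R x) \<le> t * p x" if "0 < t" for t x
    using p that by (simp add: sublinear_def)
  have "p (inverse t *\<^sub>R (t *\<^sub>R x)) \<le> inverse t * p (t *\<^sub>R x)"
    using t by (intro le) simp
  then have "t * p x \<le> p (t *\<^sub>R x)" using t by (simp add: field_simps)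
  with le[OF t] show ?thesis by (intro antisym)
qed

lemma sublinear_lower: "sublinear p \<Longrightarrow> - p (- x) \<le> p x"
  using sublinear_add[of p x "- x"] by (simp add: sublinear_zero)

text \<open>All sublinear functionals below arise as pointwise infima over some family of sets of reals:
  infima of chains, infima over translations in a direction, and upper limits, the latter being
  infima of eventual upper bounds.\<close>

lemma sublinear_Inf:
  fixes S :: "'a::real_vector \<Rightarrow> real set"
  assumes ne: "\<And>x. S x \<noteq> {}" and bdd: "\<And>x. bdd_below (S x)"
    and add: "\<And>x y a b. a \<in> S x \<Longrightarrow> b \<in> S y \<Longrightarrow> \<exists>c\<in>S (x + y). c \<le> a + b"
    and scale: "\<And>t x a. 0 < t \<Longrightarrow> a \<in> S x \<Longrightarrow> \<exists>c\<in>S (t *\<^sub>R x). c \<le> t * a"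
  shows "sublinear (\<lambda>x. Inf (S x))"
  unfolding sublinear_def
proof (intro conjI allI impI)
  fix x y
  have le: "Inf (S (x + y)) \<le> a + b" if "a \<in> S x" "b \<in> S y" for a b
    using add[OF that] cInf_lower[OF _ bdd] order_trans by blast
  have "Inf (S (x + y)) - a \<le> Inf (S y)" if "a \<in> S x" for a
    by (rule cInf_greatest[OF ne]) (use le[OF that] in \<open>simp add: algebra_simps\<close>)
  then have "Inf (S (x + y)) - Inf (S y) \<le> Inf (S x)"
    by (intro cInf_greatest[OF ne]) (simp add: algebra_simps)
  then show "Inf (S (x + y)) \<le> Inf (S x) + Inf (S y)" by simp
next
  fix t :: real and x assume t: "0 < t"
  have "Inf (S (t *\<^sub>R x)) \<le> t * a" if "a \<in> S x" for a
    using scale[OF t that] cInf_lower[OF _ bdd] order_trans by blast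
  then have "Inf (S (t *\<^sub>R x)) / t \<le> Inf (S x)"
    using t by (intro cInf_greatest[OF ne]) (simp add: field_simps)
  then show "Inf (S (t *\<^sub>R x)) \<le> t * Inf (S x)" using t by (simp add: field_simps)
qed

text \<open>The functional \<open>q x = inf\<^sub>t (p (x + t u) - t p u)\<close> replaces \<open>p\<close> by one that is additive
  along the ray spanned by \<open>u\<close>; a sublinear functional that cannot be lowered in this way for any
  \<open>u\<close> is linear.\<close>

lemma sublinear_tighten:
  assumes p: "sublinear p"
  obtains q where "sublinear q" "\<And>x. q x \<le> p x" "q (- u) \<le> - p u"
proof -
  define S where "S x = (\<lambda>t. p (x + t *\<^sub>R u) - t * p u) ` {0..}" for x
  have bdd: "bdd_below (S x)" for x
  proof (rule bdd_belowI)
    fix a assume "a \<in> S x"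
    then obtain t where t: "0 \<le> t" "a = p (x + t *\<^sub>R u) - t * p u" by (auto simp: S_def)
    have "t * p u = p ((x + t *\<^sub>R u) + - x)" by (simp add: sublinear_scale[OF p t(1)])
    also have "\<dots> \<le> p (x + t *\<^sub>R u) + p (- x)" by (rule sublinear_add[OF p])
    finally show "- p (- x) \<le> a" using t by simp
  qed
  have memI: "p (x + t *\<^sub>R u) - t * p u \<in> S x" if "0 \<le> t" for t x
    using that by (auto simp: S_def)
  have "sublinear (\<lambda>x. Inf (S x))"
  proof (rule sublinear_Inf[OF _ bdd])
    show "S x \<noteq> {}" for x by (auto simp: S_def)
  next
    fix x y a b assume "a \<in> S x" "b \<in> S y"
    then obtain s t where st: "0 \<le> s" "0 \<le> t"
      "a = p (x + s *\<^sub>R u) - s * p u" "b = p (y + t *\<^sub>R u) - t * p u" by (auto simp: S_def)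
    have "p ((x + y) + (s + t) *\<^sub>R u) \<le> p (x + s *\<^sub>R u) + p (y + t *\<^sub>R u)"
      using sublinear_add[OF p, of "x + s *\<^sub>R u" "y + t *\<^sub>R u"] by (simp add: algebra_simps)
    then have "p ((x + y) + (s + t) *\<^sub>R u) - (s + t) * p u \<le> a + b"
      using st by (simp add: algebra_simps)
    then show "\<exists>c\<in>S (x + y). c \<le> a + b" using memI[of "s + t" "x + y"] st by fastforce
  next
    fix t :: real and x a assume t: "0 < t" and "a \<in> S x"
    then obtain s where s: "0 \<le> s" "a = p (x + s *\<^sub>R u) - s * p u" by (auto simp: S_def)
    have "p (t *\<^sub>R x + (t * s) *\<^sub>R u) = t * p (x + s *\<^sub>R u)"
      using sublinear_scale[OF p, of t "x + s *\<^sub>R u"] t by (simp add: algebra_simps)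
    then have "p (t *\<^sub>R x + (t * s) *\<^sub>R u) - (t * s) * p u \<le> t * a"
      unfolding s(2) by (simp add: algebra_simps)
    then show "\<exists>c\<in>S (t *\<^sub>R x). c \<le> t * a" using memI[of "t * s" "t *\<^sub>R x"] s t by fastforce
  qed
  moreover have "Inf (S x) \<le> p x" for x
    using cInf_lower[OF memI[of 0] bdd, of x] by simp
  moreover have "Inf (S (- u)) \<le> - p u"
    using cInf_lower[OF memI[of 1] bdd, of "- u"] by (simp add: sublinear_zero[OF p])
  ultimately show ?thesis using that by blast
qed

lemma minimal_sublinear:
  assumes p: "sublinear p"
  obtains q where "sublinear q" "\<And>x. q x \<le> p x"
    "\<And>r. sublinear r \<Longrightarrow> (\<And>x. r x \<le> q x) \<Longrightarrow> r = q"
proof -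
  define A where "A = {q. sublinear q \<and> q \<le> p}"
  let ?P = "\<lambda>q r :: 'a \<Rightarrow> real. r \<le> q"
  have "\<exists>m\<in>A. \<forall>a\<in>A. ?P m a \<longrightarrow> a = m"
  proof (rule predicate_Zorn)
    show "partial_order_on A (relation_of ?P A)"
      by (rule partial_order_on_relation_ofI) auto
  next
    fix C assume "C \<in> Chains (relation_of ?P A)"
    then have C: "C \<subseteq> A" and lin: "\<And>q r. q \<in> C \<Longrightarrow> r \<in> C \<Longrightarrow> q \<le> r \<or> r \<le> q"
      unfolding Chains_def relation_of_def by blast+
    show "\<exists>u\<in>A. \<forall>a\<in>C. ?P a u"
    proof (cases "C = {}")
      case True
      have "p \<in> A" using p by (simp add: A_def)
      with True show ?thesis by blast
    next
      case False
      define S where "S x = (\<lambda>q. q x) ` C" for x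
      have sub: "sublinear q" "q x \<le> p x" if "q \<in> C" for q x
        using that C by (auto simp: A_def le_fun_def)
      have bdd: "bdd_below (S x)" for x
      proof (rule bdd_belowI)
        fix a assume "a \<in> S x"
        then obtain q where q: "q \<in> C" "a = q x" by (auto simp: S_def)
        show "- p (- x) \<le> a"
          using sublinear_lower[OF sub(1)[OF q(1)], of x] sub(2)[OF q(1), of "- x"] q(2) by simp
      qed
      have "sublinear (\<lambda>x. Inf (S x))"
      proof (rule sublinear_Inf[OF _ bdd])
        show "S x \<noteq> {}" for x using False by (simp add: S_def)
      next
        fix x y a b assume "a \<in> S x" "b \<in> S y"
        then obtain q r where qr: "q \<in> C" "r \<in> C" "a = q x" "b = r y" by (auto simp: S_def)
        from lin[OF qr(1,2)] show "\<exists>c\<in>S (x + y). c \<le> a + b"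
        proof
          assume "q \<le> r"
          then have "q (x + y) \<le> a + b"
            using sublinear_add[OF sub(1)[OF qr(1)], of x y] qr(3,4) by (force simp: le_fun_def intro: order_trans)
          with qr(1) show ?thesis by (auto simp: S_def)
        next
          assume "r \<le> q"
          then have "r (x + y) \<le> a + b"
            using sublinear_add[OF sub(1)[OF qr(2)], of x y] qr(3,4) by (force simp: le_fun_def intro: order_trans)
          with qr(2) show ?thesis by (auto simp: S_def)
        qed
      next
        fix t :: real and x a assume t: "0 < t" and "a \<in> S x"
        then obtain q where q: "q \<in> C" "a = q x" by (auto simp: S_def)
        have "q (t *\<^sub>R x) = t * a" using sublinear_scale[OF sub(1)[OF q(1)]] t q(2) by simp
        moreover have "q (t *\<^sub>R x) \<in> S (t *\<^sub>R x)" using q(1) by (auto simp: S_def)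
        ultimately show "\<exists>c\<in>S (t *\<^sub>R x). c \<le> t * a" by (metis order_refl)
      qed
      moreover have low: "Inf (S x) \<le> q x" if "q \<in> C" for q x
        using that by (intro cInf_lower bdd) (auto simp: S_def)
      moreover have "Inf (S x) \<le> p x" for x
        using False low sub(2) order_trans by blast
      ultimately have "(\<lambda>x. Inf (S x)) \<in> A" "\<forall>q\<in>C. (\<lambda>x. Inf (S x)) \<le> q"
        by (auto simp: A_def le_fun_def)
      then show ?thesis by blast
    qed
  qed
  then obtain q where q: "q \<in> A" "\<And>r. r \<in> A \<Longrightarrow> r \<le> q \<Longrightarrow> r = q" by blast
  show ?thesis
  proof (rule that)
    show "sublinear q" "q x \<le> p x" for x using q(1) by (auto simp: A_def le_fun_def)
    show "r = q" if "sublinear r" "\<And>x. r x \<le> q x" for r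
    proof (rule q(2))
      show "r \<le> q" using that(2) by (simp add: le_fun_def)
      with q(1) that(1) show "r \<in> A" by (auto simp: A_def)
    qed
  qed
qed

text \<open>A minimal sublinear functional is odd, because tightening it in any direction changes
  nothing, and an odd sublinear functional is linear. Tightening \<open>p\<close> in the direction \<open>u\<close> before
  passing to a minimal functional ensures that the bound is attained at \<open>u\<close>.\<close>

theorem Hahn_Banach_sublinear:
  assumes p: "sublinear p"
  obtains \<phi> where "linear \<phi>" "\<And>x. \<phi> x \<le> p x" "\<phi> u = p u"
proof -
  obtain p' where p': "sublinear p'" "\<And>x. p' x \<le> p x" "p' (- u) \<le> - p u"
    using sublinear_tighten[OF p, of u] by blast
  obtain q where q: "sublinear q" "\<And>x. q x \<le> p' x"
    and min: "\<And>r. sublinear r \<Longrightarrow> (\<And>x. r x \<le> q x) \<Longrightarrow> r = q"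
    by (rule minimal_sublinear[OF p'(1)]) blast
  have neg: "q (- x) = - q x" for x
  proof -
    obtain r where r: "sublinear r" "\<And>y. r y \<le> q y" "r (- x) \<le> - q x"
      using sublinear_tighten[OF q(1), of x] by blast
    have "r = q" using r(1,2) by (rule min)
    with r(3) sublinear_lower[OF q(1), of "- x"] show ?thesis by simp
  qed
  have "linear q"
  proof (rule linearI)
    fix x y
    show "q (x + y) = q x + q y"
      using sublinear_add[OF q(1), of x y] sublinear_add[OF q(1), of "- x" "- y"] neg[of "x + y"]
      by (simp add: neg)
  next
    fix t x
    show "q (t *\<^sub>R x) = t *\<^sub>R q x"
    proof (cases "0 \<le> t")
      case True
      then show ?thesis by (simp add: sublinear_scale[OF q(1)])
    next
      case False
      then show ?thesis
        using sublinear_scale[OF q(1), of "- t" x] neg[of "t *\<^sub>R x"] by simp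
    qed
  qed
  moreover have le: "q x \<le> p x" for x using q(2) p'(2) by (rule order_trans)
  moreover have "p u \<le> q u" using q(2)[of "- u"] p'(3) by (simp add: neg)
  ultimately show ?thesis using that[of q] by (simp add: antisym)
qed

text \<open>This is the Banach limit of a pointwise bounded sequence of linear functionals: the upper limit
  is sublinear, and any linear functional below it respects eventual inequalities.\<close>

lemma generalised_limit:
  fixes A :: "nat \<Rightarrow> 'a::real_vector \<Rightarrow> real"
  assumes lin: "\<And>n. linear (A n)" and bounded: "\<And>x. \<exists>M. \<forall>n. \<bar>A n x\<bar> \<le> M"
  shows "\<exists>\<phi>. linear \<phi> \<and> (\<forall>x c. (\<forall>\<^sub>F n in sequentially. A n x \<le> c) \<longrightarrow> \<phi> x \<le> c)"
proof -
  define S where "S x = {c. \<forall>\<^sub>F n in sequentially. A n x \<le> c}" for x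
  have bdd: "bdd_below (S x)" for x
  proof -
    obtain M where M: "\<And>n. \<bar>A n x\<bar> \<le> M" using bounded by blast
    show ?thesis
    proof (rule bdd_belowI)
      fix c assume "c \<in> S x"
      then obtain n where "A n x \<le> c" by (auto simp: S_def eventually_sequentially)
      with M[of n] show "- M \<le> c" by simp
    qed
  qed
  have "sublinear (\<lambda>x. Inf (S x))"
  proof (rule sublinear_Inf[OF _ bdd])
    fix x
    obtain M where "\<And>n. \<bar>A n x\<bar> \<le> M" using bounded by blast
    then have "M \<in> S x" by (simp add: S_def abs_le_iff)
    then show "S x \<noteq> {}" by blast
  next
    fix x y a b assume "a \<in> S x" "b \<in> S y"
    then have "\<forall>\<^sub>F n in sequentially. A n x \<le> a \<and> A n y \<le> b"
      by (simp add: S_def eventually_conj)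
    then have "\<forall>\<^sub>F n in sequentially. A n (x + y) \<le> a + b"
      by eventually_elim (simp add: linear_add[OF lin] add_mono)
    then show "\<exists>c\<in>S (x + y). c \<le> a + b" by (auto simp: S_def)
  next
    fix t :: real and x a assume t: "0 < t" and "a \<in> S x"
    then have "\<forall>\<^sub>F n in sequentially. A n x \<le> a" by (simp add: S_def)
    then have "\<forall>\<^sub>F n in sequentially. A n (t *\<^sub>R x) \<le> t * a"
      by eventually_elim (use t in \<open>simp add: linear_scale[OF lin]\<close>)
    then show "\<exists>c\<in>S (t *\<^sub>R x). c \<le> t * a" by (auto simp: S_def)
  qed
  then obtain \<phi> where \<phi>: "linear \<phi>" "\<And>x. \<phi> x \<le> Inf (S x)"
    by (rule Hahn_Banach_sublinear[where u = 0]) blast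
  show ?thesis
  proof (intro exI conjI allI impI)
    show "linear \<phi>" by (rule \<phi>(1))
  next
    fix x c assume "\<forall>\<^sub>F n in sequentially. A n x \<le> c"
    then have "Inf (S x) \<le> c" by (intro cInf_lower bdd) (simp add: S_def)
    with \<phi>(2)[of x] show "\<phi> x \<le> c" by simp
  qed
qed

section \<open>Positive functionals and operators on a Banach lattice\<close>

definition positive_linear ::
    "('a::real_banach_lattice \<Rightarrow> 'b::ordered_real_vector) \<Rightarrow> bool"
  where "positive_linear S \<longleftrightarrow> linear S \<and> (\<forall>x\<ge>0. 0 \<le> S x)"

lemma positive_linear_mono: "positive_linear S \<Longrightarrow> x \<le> y \<Longrightarrow> S x \<le> S y"
  using linear_diff[of S y x] by (auto simp: positive_linear_def dest: spec[of _ "y - x"])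

text \<open>If \<open>\<phi>\<close> were unbounded on the positive cone, an absolutely convergent series of positive
  vectors \<open>y n\<close> with \<open>\<phi> (y n) > 2\<^sup>n\<close> would exist; its sum dominates every \<open>y n\<close>, so \<open>\<phi>\<close> would
  be infinite there.\<close>

lemma positive_functional_bounded:
  fixes \<phi> :: "'a::real_banach_lattice \<Rightarrow> real"
  assumes \<phi>: "positive_linear \<phi>"
  obtains C where "\<And>x. \<bar>\<phi> x\<bar> \<le> C * norm x"
proof -
  have lin: "linear \<phi>" and pos: "\<And>x. 0 \<le> x \<Longrightarrow> 0 \<le> \<phi> x" using \<phi> by (auto simp: positive_linear_def)
  have "\<exists>C. \<forall>x\<ge>0. \<phi> x \<le> C * norm x"
  proof (rule ccontr)
    assume "\<not> ?thesis"
    \<comment> \<open>The growth rate \<open>4 ^ n\<close> leaves a factor \<open>2 ^ n\<close> after scaling to norm \<open>2 ^ - n\<close>.\<close>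
    then have "\<forall>n::nat. \<exists>x\<ge>0. 4 ^ n * norm x < \<phi> x" by (meson not_le)
    then obtain x where x: "\<And>n. 0 \<le> x n" "\<And>n::nat. 4 ^ n * norm (x n) < \<phi> (x n)" by metis
    have nz: "0 < norm (x n)" for n
      using x(2)[of n] linear_0[OF lin] by auto
    define y where "y n = (1 / (2 ^ n * norm (x n))) *\<^sub>R x n" for n
    have y0: "0 \<le> y n" for n by (simp add: y_def x(1) scaleR_nonneg_nonneg)
    have norm_y: "norm (y n) = (1 / 2) ^ n" for n
      using nz[of n] by (simp add: y_def power_divide)
    have \<phi>y: "2 ^ n < \<phi> (y n)" for n
    proof -
      have "\<phi> (y n) = \<phi> (x n) / (2 ^ n * norm (x n))" by (simp add: y_def linear_scale[OF lin])
      moreover have "2 ^ n * (2 ^ n * norm (x n)) < \<phi> (x n)"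
        using x(2)[of n] by (simp add: mult.assoc[symmetric] power_mult_distrib[symmetric])
      ultimately show ?thesis using nz[of n] by (simp add: pos_less_divide_eq)
    qed
    have "summable y"
      by (rule summable_norm_cancel) (simp add: norm_y summable_geometric)
    then have lim: "(\<lambda>m. \<Sum>i<m. y i) \<longlonglongrightarrow> suminf y" by (rule summable_LIMSEQ)
    have "y n \<le> suminf y" for n
    proof (rule real_banach_lattice_limit_le[OF tendsto_const LIMSEQ_ignore_initial_segment[OF lim, of "Suc n"]])
      fix m
      show "y n \<le> (\<Sum>i<m + Suc n. y i)"
        using sum_mono2[of "{..<m + Suc n}" "{n}" y] y0 by simp
    qed
    then have "2 ^ n < \<phi> (suminf y)" for n
      using \<phi>y[of n] positive_linear_mono[OF \<phi>, of "y n" "suminf y"] by (meson less_le_trans)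
    moreover obtain n where "\<phi> (suminf y) < 2 ^ n"
      using real_arch_pow[of 2 "\<phi> (suminf y)"] by auto
    ultimately show False by (meson less_asym)
  qed
  then obtain C where C: "\<And>x. 0 \<le> x \<Longrightarrow> \<phi> x \<le> C * norm x" by blast
  show ?thesis
  proof (rule that[of C])
    fix x
    have "\<phi> x \<le> \<phi> \<bar>x\<bar>" "\<phi> (- x) \<le> \<phi> \<bar>x\<bar>"
      by (auto intro: positive_linear_mono[OF \<phi>] simp: abs_ge_self abs_ge_minus_self)
    with C[of "\<bar>x\<bar>"] show "\<bar>\<phi> x\<bar> \<le> C * norm x" by (simp add: linear_neg[OF lin])
  qed
qed

text \<open>A functional dominated by the sublinear functional \<open>norm (pprt x)\<close> is positive, because
  \<open>pprt (- x) = 0\<close> for positive \<open>x\<close>.\<close>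

lemma ex_positive_functional:
  fixes u :: "'a::real_banach_lattice"
  assumes "0 \<le> u" "u \<noteq> 0"
  obtains \<psi> :: "'a \<Rightarrow> real" where "positive_linear \<psi>" "0 < \<psi> u"
proof -
  have "sublinear (\<lambda>x::'a. norm (pprt x))"
    unfolding sublinear_def
  proof (intro conjI allI impI)
    fix x y :: 'a
    have "pprt (x + y) \<le> pprt x + pprt y"
      by (subst pprt_def) (simp add: add_mono pprt_def)
    then have "norm (pprt (x + y)) \<le> norm (pprt x + pprt y)" by (intro norm_mono_nonneg) auto
    then show "norm (pprt (x + y)) \<le> norm (pprt x) + norm (pprt y)"
      using norm_triangle_ineq[of "pprt x" "pprt y"] by simp
  next
    fix t :: real and x :: 'a assume t: "0 < t"
    have "x \<le> pprt x" by (simp add: pprt_def)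
    then have "pprt (t *\<^sub>R x) \<le> t *\<^sub>R pprt x"
      using t by (subst pprt_def) (simp add: scaleR_left_mono scaleR_nonneg_nonneg)
    then have "norm (pprt (t *\<^sub>R x)) \<le> norm (t *\<^sub>R pprt x)" by (intro norm_mono_nonneg) auto
    then show "norm (pprt (t *\<^sub>R x)) \<le> t * norm (pprt x)" using t by simp
  qed
  then obtain \<psi> where \<psi>: "linear \<psi>" "\<And>x. \<psi> x \<le> norm (pprt x)" "\<psi> u = norm (pprt u)"
    by (rule Hahn_Banach_sublinear[where u = u]) blast
  have "0 \<le> \<psi> x" if "0 \<le> x" for x
    using \<psi>(2)[of "- x"] that by (simp add: linear_neg[OF \<psi>(1)])
  with \<psi> assms show ?thesis by (intro that[of \<psi>]) (auto simp: positive_linear_def)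
qed

text \<open>From \<open>b \<le> - a\<close> the positive part of \<open>b\<close> lies below the negative part of \<open>a\<close>, which is
  disjoint from the positive part.\<close>

lemma inf_pprt_eq_0:
  fixes a b :: "'a::real_banach_lattice"
  assumes "a + b \<le> 0"
  shows "inf (pprt a) (pprt b) = 0"
proof (rule antisym)
  have "b \<le> - a" using assms by (simp add: le_eq_neg add.commute)
  then have "pprt b \<le> pprt (- a)" by (rule pprt_mono)
  then have "inf (pprt a) (pprt b) \<le> inf (pprt a) (pprt (- a))" by (meson inf_mono order_refl)
  also have "pprt (- a) = pprt a - a"
    using prts[of a] by (simp add: pprt_neg algebra_simps)
  also have "inf (pprt a) (pprt a - a) = pprt a + inf 0 (- a)"
    using add_inf_distrib_left[of "pprt a" 0 "- a"] by simp
  also have "inf 0 (- a) = - sup 0 a" by (simp add: neg_sup_eq_inf)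
  also have "pprt a + - sup 0 a = 0" by (metis pprt_def sup_commute add.right_inverse)
  finally show "inf (pprt a) (pprt b) \<le> 0" .
qed simp

text \<open>Everything in the principal ideal of \<open>k\<close> is disjoint from \<open>h\<close>, so subtracting it from \<open>h\<close>
  cannot reduce the norm. In particular \<open>h\<close> is at distance \<open>norm h\<close> from that ideal.\<close>

lemma norm_le_dist_disjoint:
  fixes h k g :: "'a::real_banach_lattice"
  assumes h: "0 \<le> h" and k: "0 \<le> k" and disj: "inf h k = 0" and g: "\<bar>g\<bar> \<le> c *\<^sub>R k"
  shows "norm h \<le> norm (h - g)"
proof -
  define m where "m = max 1 c"
  define d where "d = inf h \<bar>g\<bar>"
  have m: "1 \<le> m" "c \<le> m" by (auto simp: m_def)
  have "d \<le> m *\<^sub>R h"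
    using scaleR_right_mono[OF m(1) h] by (simp add: d_def le_infI1)
  moreover have "d \<le> m *\<^sub>R k"
    using g scaleR_right_mono[OF m(2) k] by (metis d_def le_infI2 order_trans)
  ultimately have "(1 / m) *\<^sub>R d \<le> inf h k"
    using m scaleR_left_mono[of d "m *\<^sub>R h" "1 / m"] scaleR_left_mono[of d "m *\<^sub>R k" "1 / m"] by simp
  then have "d \<le> 0" using disj m scaleR_left_mono[of "(1 / m) *\<^sub>R d" 0 m] by simp
  moreover have "0 \<le> d" using h by (simp add: d_def)
  ultimately have "d = 0" by (rule antisym)
  have "h = h - inf h \<bar>g\<bar>" using \<open>d = 0\<close> by (simp add: d_def)
  also have "\<dots> = sup 0 (h - \<bar>g\<bar>)"
    by (simp only: diff_inf_eq_sup add_sup_distrib_left) simp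
  also have "\<dots> \<le> \<bar>h - g\<bar>"
  proof (rule le_supI)
    have "h \<le> \<bar>h - g\<bar> + \<bar>g\<bar>"
      using add_mono[OF abs_ge_self[of "h - g"] abs_ge_self[of g]] by simp
    then show "h - \<bar>g\<bar> \<le> \<bar>h - g\<bar>" by (simp add: algebra_simps)
  qed simp
  finally have "norm h \<le> norm \<bar>h - g\<bar>" by (rule norm_mono_nonneg[OF h])
  then show ?thesis by simp
qed

section \<open>Positive operators on the complexification\<close>

definition real_form ::
    "('a::real_banach_lattice complexification \<Rightarrow> 'a complexification) \<Rightarrow> 'a \<Rightarrow> 'a"
  where "real_form T x = real_part (T (Cplx x 0))"

text \<open>A positive operator commutes with taking real parts, since every real vector is a difference
  of positive ones. It is therefore the complexification of its real form.\<close>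

lemma positive_op_real_form:
  fixes T :: "'a::real_banach_lattice complexification \<Rightarrow> 'a complexification"
  assumes lin: "clinear_op T" and pos: "positive_op T"
  shows "positive_linear (real_form T)"
    and "T z = Cplx (real_form T (real_part z)) (real_form T (imag_part z))"
proof -
  interpret T: Vector_Spaces.linear scaleC scaleC T by (rule lin)
  have im_nonneg: "0 \<le> real_part (T (Cplx x 0)) \<and> imag_part (T (Cplx x 0)) = 0" if "0 \<le> x" for x
  proof -
    have "0 \<le> Cplx x 0" using that by (simp add: less_eq_complexification_def)
    then have "0 \<le> T (Cplx x 0)" using pos by (simp add: positive_op_def)
    then show ?thesis by (simp add: less_eq_complexification_def)
  qed
  have im: "imag_part (T (Cplx x 0)) = 0" for x
  proof -
    have "Cplx x 0 = Cplx \<bar>x\<bar> 0 - Cplx (\<bar>x\<bar> - x) 0"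
      by (rule complexification.expand) simp
    then have "T (Cplx x 0) = T (Cplx \<bar>x\<bar> 0) - T (Cplx (\<bar>x\<bar> - x) 0)"
      by (metis T.diff)
    then show ?thesis using im_nonneg[of "\<bar>x\<bar>"] im_nonneg[of "\<bar>x\<bar> - x"] by (simp add: abs_ge_self)
  qed
  have T_real: "T (Cplx x 0) = Cplx (real_form T x) 0" for x
    by (rule complexification.expand) (simp add: real_form_def im)
  have "linear (real_form T)"
  proof (rule linearI)
    fix x y :: 'a
    have "Cplx (x + y) 0 = Cplx x 0 + Cplx y 0" by (rule complexification.expand) simp
    then show "real_form T (x + y) = real_form T x + real_form T y"
      by (simp add: real_form_def T.add)
  next
    fix r and x :: 'a
    have "Cplx (r *\<^sub>R x) 0 = complex_of_real r *\<^sub>C Cplx x 0" by (rule complexification.expand) simp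
    then show "real_form T (r *\<^sub>R x) = r *\<^sub>R real_form T x"
      by (simp add: real_form_def T.scale)
  qed
  then show "positive_linear (real_form T)"
    using im_nonneg by (simp add: positive_linear_def real_form_def)
  have "z = Cplx (real_part z) 0 + \<i> *\<^sub>C Cplx (imag_part z) 0"
    by (rule complexification.expand) simp
  then have "T z = Cplx (real_form T (real_part z)) 0 + \<i> *\<^sub>C Cplx (real_form T (imag_part z)) 0"
    by (metis T.add T.scale T_real)
  then show "T z = Cplx (real_form T (real_part z)) (real_form T (imag_part z))"
    by (auto intro: complexification.expand)
qed

lemma funpow_real_form:
  fixes T :: "'a::real_banach_lattice complexification \<Rightarrow> 'a complexification"
  assumes "clinear_op T" and "positive_op T"
  shows "(T ^^ n) z = Cplx ((real_form T ^^ n) (real_part z)) ((real_form T ^^ n) (imag_part z))"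
  by (induction n) (simp_all add: positive_op_real_form(2)[OF assms, of "Cplx _ _"])

definition complexify_functional :: "('a \<Rightarrow> real) \<Rightarrow> 'a complexification \<Rightarrow> complex"
  where "complexify_functional \<phi> z = Complex (\<phi> (real_part z)) (\<phi> (imag_part z))"

lemma complexify_functional_in_dual:
  fixes \<phi> :: "'a::real_banach_lattice \<Rightarrow> real"
  assumes \<phi>: "positive_linear \<phi>"
  shows "complexify_functional \<phi> \<in> norm_dual"
    and "\<forall>g\<ge>0. 0 \<le> complexify_functional \<phi> g"
proof -
  have lin: "linear \<phi>" using \<phi> by (simp add: positive_linear_def)
  note [simp] = linear_add[OF lin] linear_diff[OF lin] linear_scale[OF lin]
  obtain C where C: "\<And>x. \<bar>\<phi> x\<bar> \<le> C * norm x" using positive_functional_bounded[OF \<phi>] by blast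
  have "vector_space ((*) :: complex \<Rightarrow> complex \<Rightarrow> complex)"
    by standard (auto simp: algebra_simps)
  then have "Vector_Spaces.linear scaleC (*) (complexify_functional \<phi>)"
    by (simp add: Vector_Spaces.linear_iff complexification.vector_space_axioms
        complexify_functional_def complex_eq_iff)
  moreover have "bounded_linear (complexify_functional \<phi>)"
  proof (rule bounded_linear_intro)
    fix z :: "'a complexification"
    have "\<bar>\<phi> x\<bar> \<le> \<bar>C\<bar> * norm z" if "norm x \<le> norm z" for x
    proof -
      have "\<bar>\<phi> x\<bar> \<le> C * norm x" by (rule C)
      also have "\<dots> \<le> \<bar>C\<bar> * norm z" using that by (intro mult_mono) auto
      finally show ?thesis .
    qed
    from this[OF norm_real_part_le] this[OF norm_imag_part_le]
    show "norm (complexify_functional \<phi> z) \<le> norm z * (2 * \<bar>C\<bar>)"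
      using cmod_le[of "complexify_functional \<phi> z"] by (simp add: complexify_functional_def algebra_simps)
  qed (simp_all add: complexify_functional_def complex_eq_iff)
  ultimately show "complexify_functional \<phi> \<in> norm_dual" by (simp add: norm_dual_def)
  show "\<forall>g\<ge>0. 0 \<le> complexify_functional \<phi> g"
    using \<phi> linear_0[OF lin]
    by (auto simp: complexify_functional_def positive_linear_def less_eq_complex_def
        less_eq_complexification_def)
qed

lemma irreducible_real_form:
  fixes T :: "'a::real_banach_lattice complexification \<Rightarrow> 'a complexification"
    and \<phi> :: "'a \<Rightarrow> real"
  assumes T: "clinear_op T" "positive_op T" and irr: "irreducible_op T"
    and \<phi>: "positive_linear \<phi>" "\<phi> y \<noteq> 0" and x: "0 \<le> x" "x \<noteq> 0"
  shows "\<exists>n. 0 < \<phi> ((real_form T ^^ n) x)"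
proof -
  let ?\<Phi> = "complexify_functional \<phi>"
  have "?\<Phi> (Cplx y 0) \<noteq> 0"
    using \<phi>(2) by (simp add: complexify_functional_def complex_eq_iff)
  then have "?\<Phi> \<noteq> (\<lambda>_. 0)" by auto
  moreover have "0 \<le> Cplx x 0" "Cplx x 0 \<noteq> 0"
    using x by (auto simp: less_eq_complexification_def zero_complexification_def)
  ultimately obtain n where "0 < ?\<Phi> ((T ^^ n) (Cplx x 0))"
    using irr complexify_functional_in_dual[OF \<phi>(1)] unfolding irreducible_op_def by blast
  then have "0 < \<phi> ((real_form T ^^ n) x)"
    by (simp add: funpow_real_form[OF T] complexify_functional_def less_complex_def)
  then show ?thesis ..
qed

section \<open>Invariant functionals\<close>

text \<open>Weakly compact sets have compact image under every functional in the norm dual; boundedness of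
  the scalar orbits is the consequence of weak almost periodicity on which the proof rests.\<close>

lemma weakly_almost_periodic_bounded:
  fixes T :: "'a::real_banach_lattice complexification \<Rightarrow> 'a complexification"
  assumes wap: "weakly_almost_periodic T" and \<phi>: "\<phi> \<in> norm_dual"
  shows "bounded (range (\<lambda>n. \<phi> ((T ^^ n) f)))"
proof -
  let ?W = "weak_topology :: 'a complexification topology"
  have weak_open: "openin ?W (\<phi> -` U)" if "open U" for U
    unfolding weak_topology_def using \<phi> that by (intro topology_generated_by_Basis) blast
  have top: "topspace ?W = UNIV"
    using openin_subset[OF weak_open[of UNIV]] by auto
  have "continuous_map ?W euclidean \<phi>"
    using weak_open by (simp add: continuous_map_def top vimage_def)
  then have "compactin euclidean (\<phi> ` (?W closure_of range (\<lambda>n. (T ^^ n) f)))"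
    using wap image_compactin unfolding weakly_almost_periodic_def by blast
  then have "bounded (\<phi> ` (?W closure_of range (\<lambda>n. (T ^^ n) f)))"
    by (simp add: compact_imp_bounded)
  moreover have "range (\<lambda>n. \<phi> ((T ^^ n) f)) \<subseteq> \<phi> ` (?W closure_of range (\<lambda>n. (T ^^ n) f))"
    using closure_of_subset[of "range (\<lambda>n. (T ^^ n) f)" ?W] by (auto simp: top)
  ultimately show ?thesis by (rule bounded_subset)
qed

text \<open>A Banach limit of the Cesaro means of \<open>\<psi> \<circ> T\<^sup>k\<close> is invariant. It is non-zero at \<open>u\<close>
  because the orbit of \<open>u\<close> stays above \<open>u\<close>.\<close>

lemma ex_invariant_functional:
  fixes T :: "'a::real_banach_lattice complexification \<Rightarrow> 'a complexification"
  assumes T: "clinear_op T" "positive_op T" and wap: "weakly_almost_periodic T"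
    and u: "0 \<le> u" "u \<noteq> 0" "u \<le> real_form T u"
  obtains \<phi> :: "'a \<Rightarrow> real"
  where "positive_linear \<phi>" "\<And>x. \<phi> (real_form T x) = \<phi> x" "0 < \<phi> u"
proof -
  let ?\<tau> = "real_form T"
  have \<tau>: "positive_linear ?\<tau>" by (rule positive_op_real_form(1)[OF T])
  then have lin_\<tau>: "linear ?\<tau>" by (simp add: positive_linear_def)
  obtain \<psi> :: "'a \<Rightarrow> real" where \<psi>: "positive_linear \<psi>" "0 < \<psi> u"
    by (rule ex_positive_functional[OF u(1,2)])
  have lin_\<psi>: "linear \<psi>" using \<psi>(1) by (simp add: positive_linear_def)
  have bounded: "\<exists>M. \<forall>k. \<bar>\<psi> ((?\<tau> ^^ k) x)\<bar> \<le> M" for x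
  proof -
    obtain M where M: "\<And>k. cmod (complexify_functional \<psi> ((T ^^ k) (Cplx x 0))) \<le> M"
      using weakly_almost_periodic_bounded[OF wap complexify_functional_in_dual(1)[OF \<psi>(1)], of "Cplx x 0"]
      unfolding bounded_iff by blast
    have "\<bar>\<psi> ((?\<tau> ^^ k) x)\<bar> \<le> M" for k
      using order_trans[OF abs_Re_le_cmod M[of k]]
      by (simp add: funpow_real_form[OF T] complexify_functional_def)
    then show ?thesis by blast
  qed
  have lin_pow: "linear (?\<tau> ^^ k)" for k
  proof (induction k)
    case 0
    show ?case unfolding funpow.simps by (rule linear_id)
  next
    case (Suc k)
    then show ?case unfolding funpow.simps by (rule linear_compose[OF _ lin_\<tau>])
  qed
  define A where "A n x = (1 / real (Suc n)) * (\<Sum>k<Suc n. \<psi> ((?\<tau> ^^ k) x))" for n x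
  have A_lin: "linear (A n)" for n
    by (rule linearI)
      (simp_all add: A_def linear_add[OF lin_pow] linear_add[OF lin_\<psi>] linear_scale[OF lin_pow]
        linear_scale[OF lin_\<psi>] sum.distrib sum_distrib_left[symmetric] algebra_simps
        del: sum.lessThan_Suc of_nat_Suc)
  have A_le: "A n x \<le> M" if "\<And>k. \<psi> ((?\<tau> ^^ k) x) \<le> M" for n x M
  proof -
    have "(\<Sum>k<Suc n. \<psi> ((?\<tau> ^^ k) x)) \<le> (\<Sum>k<Suc n. M)" by (intro sum_mono that)
    then show ?thesis by (simp add: A_def field_simps del: sum.lessThan_Suc)
  qed
  have "\<exists>M. \<forall>n. \<bar>A n x\<bar> \<le> M" for x
  proof -
    obtain M where M: "\<And>k. \<bar>\<psi> ((?\<tau> ^^ k) x)\<bar> \<le> M" using bounded by blast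
    have "A n x \<le> M" "A n (- x) \<le> M" for n
      using M by (auto intro!: A_le simp: abs_le_iff linear_neg[OF lin_pow] linear_neg[OF lin_\<psi>])
    then show ?thesis by (auto simp: abs_le_iff linear_neg[OF A_lin])
  qed
  then have "\<exists>\<phi>. linear \<phi> \<and> (\<forall>x c. (\<forall>\<^sub>F n in sequentially. A n x \<le> c) \<longrightarrow> \<phi> x \<le> c)"
    by (intro generalised_limit A_lin)
  then obtain \<phi> where \<phi>: "linear \<phi>" "\<And>x c. (\<forall>\<^sub>F n in sequentially. A n x \<le> c) \<Longrightarrow> \<phi> x \<le> c"
    by auto
  have \<phi>_le: "\<phi> x \<le> M" if "\<And>k. \<psi> ((?\<tau> ^^ k) x) \<le> M" for x M
    using A_le[OF that] by (intro \<phi>(2)) simp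
  have \<phi>_ge: "M \<le> \<phi> x" if "\<And>k. M \<le> \<psi> ((?\<tau> ^^ k) x)" for x M
    using \<phi>_le[of "- x" "- M"] that
    by (simp add: linear_neg[OF lin_pow] linear_neg[OF lin_\<psi>] linear_neg[OF \<phi>(1)])
  have pos_pow: "0 \<le> (?\<tau> ^^ k) x" if "0 \<le> x" for k x
    using \<tau> that by (induction k) (auto simp: positive_linear_def)
  have "0 \<le> \<phi> x" if "0 \<le> x" for x
    using pos_pow[OF that] \<psi>(1) by (intro \<phi>_ge) (simp add: positive_linear_def)
  then have "positive_linear \<phi>" using \<phi>(1) by (simp add: positive_linear_def)
  moreover have "0 < \<phi> u"
  proof -
    have "u \<le> (?\<tau> ^^ k) u" for k
    proof (induction k)
      case (Suc k)
      show ?case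
        using order_trans[OF u(3) positive_linear_mono[OF \<tau> Suc]] by simp
    qed simp
    then have "\<psi> u \<le> \<phi> u" by (intro \<phi>_ge positive_linear_mono[OF \<psi>(1)])
    with \<psi>(2) show ?thesis by simp
  qed
  moreover have "\<phi> (?\<tau> x) = \<phi> x" for x
  proof -
    \<comment> \<open>The means of \<open>T x - x\<close> telescope and are of order \<open>1 / n\<close>; \<open>s = \<plusminus> 1\<close> covers both
      inequalities.\<close>
    have small: "\<phi> (s *\<^sub>R (?\<tau> x - x)) \<le> 0" if s: "\<bar>s\<bar> = 1" for s
    proof (rule field_le_epsilon)
      fix e :: real assume e: "0 < e"
      obtain M where M: "\<And>k. \<bar>\<psi> ((?\<tau> ^^ k) x)\<bar> \<le> M" using bounded by blast
      have tele: "A n (s *\<^sub>R (?\<tau> x - x)) = s * (\<psi> ((?\<tau> ^^ Suc n) x) - \<psi> x) / real (Suc n)" for n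
      proof -
        have "(\<Sum>k<Suc n. \<psi> ((?\<tau> ^^ k) (?\<tau> x - x))) = (\<Sum>k<Suc n. \<psi> ((?\<tau> ^^ Suc k) x) - \<psi> ((?\<tau> ^^ k) x))"
          by (intro sum.cong refl)
            (simp only: linear_diff[OF lin_pow] linear_diff[OF lin_\<psi>] funpow_Suc_right comp_apply)
        also have "\<dots> = \<psi> ((?\<tau> ^^ Suc n) x) - \<psi> ((?\<tau> ^^ 0) x)" by (rule sum_lessThan_telescope)
        finally have "A n (?\<tau> x - x) = (1 / real (Suc n)) * (\<psi> ((?\<tau> ^^ Suc n) x) - \<psi> x)"
          by (simp only: A_def) simp
        then show ?thesis by (simp add: linear_scale[OF A_lin] del: of_nat_Suc)
      qed
      have "A n (s *\<^sub>R (?\<tau> x - x)) \<le> e" if n: "nat \<lceil>2 * M / e\<rceil> \<le> n" for n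
      proof -
        have "2 * M / e \<le> real (Suc n)" using n by linarith
        then have "2 * M \<le> e * real (Suc n)" using e by (simp add: field_simps)
        moreover have "s * (\<psi> ((?\<tau> ^^ Suc n) x) - \<psi> x) \<le> \<bar>\<psi> ((?\<tau> ^^ Suc n) x) - \<psi> x\<bar>"
          using abs_ge_self[of "s * (\<psi> ((?\<tau> ^^ Suc n) x) - \<psi> x)"] s by (simp add: abs_mult)
        moreover have "\<bar>\<psi> ((?\<tau> ^^ Suc n) x) - \<psi> x\<bar> \<le> 2 * M"
          using M[of "Suc n"] M[of 0] unfolding funpow_0 by linarith
        ultimately have "s * (\<psi> ((?\<tau> ^^ Suc n) x) - \<psi> x) \<le> e * real (Suc n)" by linarith
        then show ?thesis unfolding tele by (simp add: pos_divide_le_eq del: of_nat_Suc funpow.simps)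
      qed
      then show "\<phi> (s *\<^sub>R (?\<tau> x - x)) \<le> 0 + e"
        by (intro \<phi>(2) eventually_sequentiallyI[of "nat \<lceil>2 * M / e\<rceil>"]) simp
    qed
    from small[of 1] small[of "- 1"] show ?thesis
      by (simp add: linear_diff[OF \<phi>(1)] linear_neg[OF \<phi>(1)])
  qed
  ultimately show ?thesis using that by blast
qed

section \<open>Rotations\<close>

text \<open>A convergent subsequence of the powers has two terms that are close to each other; their
  quotient is the required power.\<close>

lemma power_near_1:
  fixes \<mu> :: complex
  assumes "cmod \<mu> = 1" and "0 < e"
  obtains n where "cmod (\<mu> ^ Suc n - 1) < e"
proof -
  have "\<forall>k. \<mu> ^ k \<in> sphere 0 1" using assms by (simp add: norm_power)
  moreover have "compact (sphere (0::complex) 1)" by (rule compact_sphere)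
  ultimately obtain l r where r: "strict_mono r" "((\<lambda>k. \<mu> ^ k) \<circ> r) \<longlonglongrightarrow> l"
    unfolding compact_def by metis
  from LIMSEQ_imp_Cauchy[OF r(2)] obtain N
    where N: "\<And>m n. m \<ge> N \<Longrightarrow> n \<ge> N \<Longrightarrow> dist (\<mu> ^ r m) (\<mu> ^ r n) < e"
    using \<open>0 < e\<close> unfolding Cauchy_def comp_def by meson
  have "r N < r (Suc N)" using r(1) by (simp add: strict_mono_Suc_iff)
  then obtain n where n: "r (Suc N) = r N + Suc n" using less_imp_Suc_add by auto
  have "\<mu> ^ r (Suc N) - \<mu> ^ r N = \<mu> ^ r N * (\<mu> ^ Suc n - 1)"
    unfolding n power_add by (simp add: algebra_simps)
  then have "cmod (\<mu> ^ Suc n - 1) = dist (\<mu> ^ r (Suc N)) (\<mu> ^ r N)"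
    using assms(1) by (simp add: dist_norm norm_mult norm_power)
  with N[of "Suc N" N] have "cmod (\<mu> ^ Suc n - 1) < e" by simp
  then show ?thesis by (rule that)
qed

lemma positive_linear_pprt:
  fixes S :: "'a::real_banach_lattice \<Rightarrow> 'a"
  assumes S: "positive_linear S"
  shows "pprt (S x) \<le> S (pprt x)"
proof -
  have "S x \<le> S (pprt x)" by (intro positive_linear_mono[OF S]) (simp add: pprt_def)
  moreover have "0 \<le> S (pprt x)" using S by (simp add: positive_linear_def)
  ultimately show ?thesis by (subst pprt_def) simp
qed

text \<open>Let \<open>a w\<close> be the positive part on the right-hand side. Positivity gives
  \<open>a (\<mu> w) \<le> \<tau> (a w)\<close>, so \<open>\<phi> (a (\<mu>\<^sup>n w))\<close> decreases in \<open>n\<close>. It depends continuously on \<open>w\<close> and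
  \<open>\<mu>\<^sup>n w\<close> returns close to \<open>w\<close>, so it is constant, and strict positivity of \<open>\<phi>\<close> turns this into
  equality. The vectors \<open>R w\<close> are meant to be the real parts of the multiples \<open>w f\<close> of an
  eigenvector \<open>f\<close> with modulus \<open>u\<close>.\<close>

lemma pprt_rotation:
  fixes \<tau> :: "'a::real_banach_lattice \<Rightarrow> 'a" and R :: "complex \<Rightarrow> 'a"
  assumes \<tau>: "positive_linear \<tau>"
    and \<phi>: "positive_linear \<phi>" "\<And>x. \<phi> (\<tau> x) = \<phi> x"
    and strict: "\<And>x. 0 \<le> x \<Longrightarrow> \<phi> x = (0::real) \<Longrightarrow> x = 0"
    and u: "\<tau> u = u" and mu: "cmod \<mu> = 1"
    and R: "\<And>w. \<tau> (R w) = R (\<mu> * w)"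
    and lip: "\<And>w w'. R w - R w' \<le> cmod (w - w') *\<^sub>R u"
  shows "\<tau> (pprt (R w - c *\<^sub>R u)) = pprt (R (\<mu> * w) - c *\<^sub>R u)"
proof -
  have lin_\<tau>: "linear \<tau>" and lin_\<phi>: "linear \<phi>" using \<tau> \<phi>(1) by (auto simp: positive_linear_def)
  define a where "a w = pprt (R w - c *\<^sub>R u)" for w
  have step: "a (\<mu> * w) \<le> \<tau> (a w)" for w
    using positive_linear_pprt[OF \<tau>, of "R w - c *\<^sub>R u"]
    by (simp add: a_def linear_diff[OF lin_\<tau>] linear_scale[OF lin_\<tau>] R u)
  have decr1: "\<phi> (a (\<mu> * w)) \<le> \<phi> (a w)" for w
    using positive_linear_mono[OF \<phi>(1) step] by (simp add: \<phi>(2))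
  have decr: "\<phi> (a (\<mu> ^ n * w)) \<le> \<phi> (a w)" for n w
  proof (induction n)
    case (Suc n)
    with decr1[of "\<mu> ^ n * w"] show ?case by (simp add: mult.assoc)
  qed simp
  have cont: "\<phi> (a w) \<le> \<phi> (a w') + cmod (w - w') * \<phi> u" for w w'
  proof -
    have "R w - c *\<^sub>R u \<le> a w' + cmod (w - w') *\<^sub>R u"
    proof -
      have "R w - c *\<^sub>R u = (R w' - c *\<^sub>R u) + (R w - R w')" by simp
      also have "\<dots> \<le> a w' + cmod (w - w') *\<^sub>R u"
        by (intro add_mono lip) (simp add: a_def pprt_def)
      finally show ?thesis .
    qed
    moreover have "0 \<le> cmod (w - w') *\<^sub>R u"
      using add_mono[OF lip[of w w'] lip[of w' w]]
      by (simp add: norm_minus_commute)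
    ultimately have "a w \<le> a w' + cmod (w - w') *\<^sub>R u"
      by (subst a_def, subst pprt_def) (simp add: a_def)
    from positive_linear_mono[OF \<phi>(1) this] show ?thesis
      by (simp add: linear_add[OF lin_\<phi>] linear_scale[OF lin_\<phi>])
  qed
  have "\<phi> (a w) \<le> \<phi> (a (\<mu> * w))"
  proof (rule field_le_epsilon)
    fix e :: real assume e: "0 < e"
    \<comment> \<open>The summand \<open>1\<close> keeps the denominator positive when \<open>w = 0\<close>.\<close>
    define \<delta> where "\<delta> = e / (1 + cmod w * \<bar>\<phi> u\<bar>)"
    have pos: "0 < 1 + cmod w * \<bar>\<phi> u\<bar>" by (simp add: add_pos_nonneg)
    with e have "0 < \<delta>" by (simp add: \<delta>_def)
    then obtain n where n: "cmod (\<mu> ^ Suc n - 1) < \<delta>" using power_near_1[OF mu] by blast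
    have "w - \<mu> ^ Suc n * w = - ((\<mu> ^ Suc n - 1) * w)" by (simp add: algebra_simps)
    then have "cmod (w - \<mu> ^ Suc n * w) * \<phi> u = cmod (\<mu> ^ Suc n - 1) * (cmod w * \<phi> u)"
      by (simp only: norm_minus_cancel norm_mult mult.assoc)
    also have "\<dots> \<le> \<delta> * (1 + cmod w * \<bar>\<phi> u\<bar>)"
    proof -
      have "cmod w * \<phi> u \<le> 1 + cmod w * \<bar>\<phi> u\<bar>"
        using mult_left_mono[OF abs_ge_self[of "\<phi> u"], of "cmod w"] by simp
      then have "cmod (\<mu> ^ Suc n - 1) * (cmod w * \<phi> u) \<le> cmod (\<mu> ^ Suc n - 1) * (1 + cmod w * \<bar>\<phi> u\<bar>)"
        by (intro mult_left_mono) auto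
      also have "\<dots> \<le> \<delta> * (1 + cmod w * \<bar>\<phi> u\<bar>)" using n pos by (intro mult_right_mono) auto
      finally show ?thesis .
    qed
    also have "\<dots> = e" using pos by (simp add: \<delta>_def)
    finally have "\<phi> (a w) \<le> \<phi> (a (\<mu> ^ Suc n * w)) + e" using cont[of w "\<mu> ^ Suc n * w"] by linarith
    also have "\<phi> (a (\<mu> ^ Suc n * w)) \<le> \<phi> (a (\<mu> * w))"
      using decr[of n "\<mu> * w"] by (simp add: ac_simps)
    finally show "\<phi> (a w) \<le> \<phi> (a (\<mu> * w)) + e" by simp
  qed
  with decr1[of w] have "\<phi> (\<tau> (a w) - a (\<mu> * w)) = 0" by (simp add: linear_diff[OF lin_\<phi>] \<phi>(2))
  with step[of w] have "\<tau> (a w) - a (\<mu> * w) = 0" by (intro strict) auto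
  then show ?thesis by (simp add: a_def)
qed

section \<open>The point spectrum on the unit circle\<close>

theorem theorem3p1:
  fixes T :: "'a::real_banach_lattice complexification \<Rightarrow> 'a complexification"
    and B :: "'a complexification set"
  assumes "clinear_op T"
    and "positive_op T"
    and "weakly_almost_periodic T"
    and "irreducible_op T"
    and "projection_band B" and "B \<noteq> {0}"
    and "\<And>f. f \<in> B \<Longrightarrow> 0 \<le> f \<Longrightarrow>
           closure (principal_ideal f) \<subseteq> closure (principal_ideal (T f))"
  shows "point_spectrum T \<inter> {\<mu>. cmod \<mu> = 1} \<subseteq> {1}"
proof (clarsimp simp: point_spectrum_def, rule ccontr)
  fix \<mu> :: complex and f
  assume mu: "cmod \<mu> = 1" and f: "f \<noteq> 0" "T f = \<mu> *\<^sub>C f" and "\<mu> \<noteq> 1"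
  note T = assms(1,2)
  interpret T: Vector_Spaces.linear scaleC scaleC T by (rule assms(1))
  define \<tau> where "\<tau> = real_form T"
  have \<tau>: "positive_linear \<tau>" unfolding \<tau>_def by (rule positive_op_real_form(1)[OF T])
  then have lin_\<tau>: "linear \<tau>" and pos_\<tau>: "\<And>x. 0 \<le> x \<Longrightarrow> 0 \<le> \<tau> x" by (auto simp: positive_linear_def)
  have T_parts: "T z = Cplx (\<tau> (real_part z)) (\<tau> (imag_part z))" for z
    unfolding \<tau>_def by (rule positive_op_real_form(2)[OF T])
  define R where "R w = real_part (w *\<^sub>C f)" for w
  define u where "u = modulus f"
  have u0: "0 \<le> u" by (simp add: u_def)
  have "norm u \<noteq> 0" using f(1) by (simp add: u_def flip: norm_complexification_def)
  then have u_ne: "u \<noteq> 0" by auto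
  have R_add: "R (w + w') = R w + R w'" and R_diff: "R (w - w') = R w - R w'" for w w'
    by (simp_all add: R_def algebra_simps)
  have \<tau>R: "\<tau> (R w) = R (\<mu> * w)" for w
  proof -
    have "\<tau> (R w) = real_part (T (w *\<^sub>C f))" by (simp add: T_parts R_def)
    also have "\<dots> = R (\<mu> * w)" by (simp add: T.scale f(2) R_def mult.commute)
    finally show ?thesis .
  qed
  have R_le: "R w \<le> cmod w *\<^sub>R u" for w
    using order_trans[OF abs_ge_self abs_real_part_le_modulus[of "w *\<^sub>C f"]]
    by (simp add: modulus_scaleC R_def u_def)
  have u_least: "u \<le> b" if "\<And>w. cmod w = 1 \<Longrightarrow> R w \<le> b" for b
    unfolding u_def
  proof (rule modulus_least)
    fix \<theta>
    have "rot f \<theta> = R (cis (- \<theta>))" by (simp add: rot_def R_def)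
    with that[of "cis (- \<theta>)"] show "rot f \<theta> \<le> b" by simp
  qed
  have "u \<le> \<tau> u"
  proof (rule u_least)
    fix w :: complex assume w: "cmod w = 1"
    have "R w = \<tau> (R (w / \<mu>))" using mu by (auto simp: \<tau>R)
    also have "\<dots> \<le> \<tau> u"
      using R_le[of "w / \<mu>"] by (intro positive_linear_mono[OF \<tau>]) (simp add: norm_divide w mu)
    finally show "R w \<le> \<tau> u" .
  qed
  then obtain \<phi> :: "'a \<Rightarrow> real" where \<phi>: "positive_linear \<phi>" "\<And>x. \<phi> (\<tau> x) = \<phi> x" "0 < \<phi> u"
    using ex_invariant_functional[OF T assms(3) u0 u_ne] unfolding \<tau>_def by blast
  have strict: "x = 0" if x: "0 \<le> x" "\<phi> x = 0" for x
  proof (rule ccontr)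
    assume "x \<noteq> 0"
    then obtain n where "0 < \<phi> ((\<tau> ^^ n) x)"
      using irreducible_real_form[OF T assms(4) \<phi>(1) _ x(1), of u] \<phi>(3) unfolding \<tau>_def by auto
    moreover have "\<phi> ((\<tau> ^^ n) x) = \<phi> x" by (induction n) (simp_all add: \<phi>(2))
    ultimately show False using x(2) by simp
  qed
  have \<tau>u: "\<tau> u = u"
    using strict[of "\<tau> u - u"] \<open>u \<le> \<tau> u\<close> \<phi>(1,2) linear_diff[of \<phi> "\<tau> u" u]
    by (simp add: positive_linear_def)
  \<comment> \<open>Strict convexity of the unit disc: this is where \<open>\<mu> \<noteq> 1\<close> enters.\<close>
  have "cmod (1 + \<mu>) < 2"
  proof (rule ccontr)
    assume "\<not> cmod (1 + \<mu>) < 2"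
    moreover have "cmod (1 + \<mu>) \<le> 2" using norm_triangle_ineq[of 1 \<mu>] mu by simp
    ultimately have "norm (1 + \<mu>) = norm (1::complex) + norm \<mu>" using mu by simp
    then have "norm (1::complex) *\<^sub>R \<mu> = norm \<mu> *\<^sub>R 1" by (simp only: norm_triangle_eq)
    with mu \<open>\<mu> \<noteq> 1\<close> show False by simp
  qed
  define c where "c = cmod (1 + \<mu>) / 2"
  have c: "c < 1" using \<open>cmod (1 + \<mu>) < 2\<close> by (simp add: c_def)
  define a where "a w = pprt (R w - c *\<^sub>R u)" for w
  have \<tau>a: "\<tau> (a w) = a (\<mu> * w)" for w
    unfolding a_def
    using R_le by (intro pprt_rotation[where \<phi> = \<phi>] \<tau> \<phi>(1,2) \<tau>u mu \<tau>R strict) (simp_all flip: R_diff)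
  have disj: "inf (a w) (\<tau> (a w)) = 0" if w: "cmod w = 1" for w
  proof -
    have "R w + R (\<mu> * w) = R ((1 + \<mu>) * w)" by (simp add: algebra_simps flip: R_add)
    also have "\<dots> \<le> (2 * c) *\<^sub>R u" using R_le[of "(1 + \<mu>) * w"] by (simp add: norm_mult w c_def)
    finally have "(R w - c *\<^sub>R u) + (R (\<mu> * w) - c *\<^sub>R u) \<le> 0"
      by (simp add: algebra_simps scaleR_2 flip: scaleR_scaleR)
    then show ?thesis unfolding \<tau>a unfolding a_def by (rule inf_pprt_eq_0)
  qed
  obtain P where P: "clinear_op P" "range P = B" "\<And>z. 0 \<le> z \<Longrightarrow> 0 \<le> P z \<and> P z \<le> z"
    using assms(5) unfolding projection_band_def by blast
  have "positive_op P" using P(3) by (simp add: positive_op_def)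
  note P' = P(1) this
  define \<pi> where "\<pi> = real_form P"
  have \<pi>: "positive_linear \<pi>" unfolding \<pi>_def by (rule positive_op_real_form(1)[OF P'])
  then have lin_\<pi>: "linear \<pi>" and pos_\<pi>: "\<And>x. 0 \<le> x \<Longrightarrow> 0 \<le> \<pi> x" by (auto simp: positive_linear_def)
  have P_parts: "P z = Cplx (\<pi> (real_part z)) (\<pi> (imag_part z))" for z
    unfolding \<pi>_def by (rule positive_op_real_form(2)[OF P'])
  have \<pi>_le: "\<pi> x \<le> x" if "0 \<le> x" for x
    using P(3)[of "Cplx x 0"] that by (simp add: less_eq_complexification_def P_parts)
  have \<pi>a: "\<pi> (a w) = 0" if w: "cmod w = 1" for w
  proof -
    define h where "h = \<pi> (a w)"
    have a0: "0 \<le> a w" by (simp add: a_def)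
    then have h0: "0 \<le> h" and ha: "h \<le> a w" by (simp_all add: h_def pos_\<pi> \<pi>_le)
    have "inf h (\<tau> h) \<le> inf (a w) (\<tau> (a w))"
      by (intro inf_mono ha positive_linear_mono[OF \<tau>])
    then have dh: "inf h (\<tau> h) = 0"
      using disj[OF w] h0 pos_\<tau>[OF h0] by (intro antisym) auto
    let ?h = "Cplx h 0"
    have hP: "?h = P (Cplx (a w) 0)"
      by (simp add: P_parts h_def linear_0[OF lin_\<pi>])
    have "?h \<in> B" using P(2) hP by blast
    moreover have "0 \<le> ?h" using h0 by (simp add: less_eq_complexification_def)
    ultimately have "closure (principal_ideal ?h) \<subseteq> closure (principal_ideal (T ?h))"
      by (rule assms(7))
    moreover have "?h \<in> principal_ideal ?h"
    proof -
      have "modulus ?h \<le> h" using modulus_le_sum[of ?h] h0 by simp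
      then show ?thesis
        by (auto simp: principal_ideal_def abs_complexification_def less_eq_complexification_def intro!: exI[of _ 1])
    qed
    ultimately have cl: "?h \<in> closure (principal_ideal (T ?h))" using closure_subset by blast
    have "norm h \<le> 0"
    proof (rule field_le_epsilon)
      fix e :: real assume "0 < e"
      with cl obtain g where g: "g \<in> principal_ideal (T ?h)" "dist g ?h < e"
        unfolding closure_approachable by blast
      then obtain k where "modulus g \<le> k *\<^sub>R \<tau> h"
        by (auto simp: principal_ideal_def abs_complexification_def less_eq_complexification_def T_parts)
      then have "\<bar>real_part g\<bar> \<le> k *\<^sub>R \<tau> h" by (rule order_trans[OF abs_real_part_le_modulus])
      then have "norm h \<le> norm (h - real_part g)"
        by (rule norm_le_dist_disjoint[OF h0 pos_\<tau>[OF h0] dh])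
      also have "\<dots> \<le> norm (?h - g)" using norm_real_part_le[of "?h - g"] by simp
      also have "\<dots> \<le> e" using g(2) by (simp add: dist_norm norm_minus_commute)
      finally show "norm h \<le> 0 + e" by simp
    qed
    then show ?thesis by (simp add: h_def)
  qed
  have \<pi>u: "\<pi> u = 0"
  proof (rule antisym)
    \<comment> \<open>Splitting \<open>R w\<close> along the band before the supremum over \<open>w\<close> is taken avoids
      interchanging \<open>\<pi>\<close> with suprema.\<close>
    have "u \<le> c *\<^sub>R \<pi> u + (u - \<pi> u)"
    proof (rule u_least)
      fix w :: complex assume w: "cmod w = 1"
      have "R w - c *\<^sub>R u \<le> a w" by (simp add: a_def pprt_def)
      from positive_linear_mono[OF \<pi> this] have "\<pi> (R w) \<le> c *\<^sub>R \<pi> u"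
        by (simp add: \<pi>a[OF w] linear_diff[OF lin_\<pi>] linear_scale[OF lin_\<pi>])
      moreover have "R w - \<pi> (R w) \<le> u - \<pi> u"
        using \<pi>_le[of "u - R w"] R_le[of w] by (simp add: w linear_diff[OF lin_\<pi>] algebra_simps)
      ultimately show "R w \<le> c *\<^sub>R \<pi> u + (u - \<pi> u)" using add_mono by fastforce
    qed
    then have "(1 - c) *\<^sub>R \<pi> u \<le> 0" by (simp add: algebra_simps)
    with scaleR_left_mono[OF this, of "1 / (1 - c)"] c show "\<pi> u \<le> 0" by simp
  qed (rule pos_\<pi>[OF u0])
  obtain y where "0 \<le> y" "\<pi> y \<noteq> 0"
  proof -
    have "\<exists>y\<ge>0. \<pi> y \<noteq> 0"
    proof (rule ccontr)
      assume "\<not> ?thesis"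
      then have zero: "\<pi> y = 0" if "0 \<le> y" for y using that by blast
      have "\<pi> x = 0" for x
        using zero[of "\<bar>x\<bar>"] zero[of "\<bar>x\<bar> - x"] by (simp add: abs_ge_self linear_diff[OF lin_\<pi>])
      then have "P z = 0" for z by (simp add: P_parts zero_complexification_def)
      then have "B \<subseteq> {0}" using P(2) by auto
      moreover have "0 \<in> B" using P(2) \<open>\<And>z. P z = 0\<close> by (metis rangeI)
      ultimately show False using assms(6) by blast
    qed
    then show ?thesis using that by blast
  qed
  then obtain \<psi> :: "'a \<Rightarrow> real" where \<psi>: "positive_linear \<psi>" "0 < \<psi> (\<pi> y)"
    using ex_positive_functional pos_\<pi> by blast
  have "positive_linear (\<lambda>x. \<psi> (\<pi> x))"
    using \<pi> \<psi>(1) linear_compose[of \<pi> \<psi>] by (simp add: positive_linear_def comp_def)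
  then obtain n where "0 < \<psi> (\<pi> ((\<tau> ^^ n) u))"
    using irreducible_real_form[OF T assms(4) _ _ u0 u_ne, of "\<lambda>x. \<psi> (\<pi> x)" y] \<psi>(2)
    unfolding \<tau>_def by auto
  moreover have "(\<tau> ^^ n) u = u" by (induction n) (simp_all add: \<tau>u)
  moreover have "\<psi> 0 = 0" using \<psi>(1) by (simp add: positive_linear_def linear_0)
  ultimately show False by (simp add: \<pi>u)
qed

end
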